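(* Let $\mathcal{G}$ be a continuous stochastic potential game with potential $\phi:\mathcal{S}\times\boldsymbol{\mathcal{A}}\to\mathbb{R}$, satisfying the standing assumptions listed in the context. Let $\boldsymbol{\pi}\in\boldsymbol{\Pi}$, define $B_\epsilon^{\boldsymbol{\tilde\pi}}:=\lim_{k\to\infty}T_{\phi_\epsilon}^kB^{\boldsymbol{\pi}}$ for a function $\phi_\epsilon:\mathcal{S}\times\boldsymbol{\mathcal{A}}\to\mathbb{R}$, and let the policy $\boldsymbol{\hat\pi}$ be a Markov perfect equilibrium strategy of $\mathcal{G}$ (so that $\lim_{k\to\infty}T_\phi^kB^{\boldsymbol{\pi}}=B^{\boldsymbol{\hat\pi}}$). Then for any $\epsilon>0$, $$\|B^{\boldsymbol{\hat\pi}}-B_\epsilon^{\boldsymbol{\tilde\pi}}\|\le(2-\gamma)(1-\gamma)^{-1}\epsilon$$ whenever $\|\phi_\epsilon-\phi\|<\epsilon$.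
   Context: A continuous stochastic game is a tuple $\mathcal{G}=\langle \mathcal{N},\mathcal{S},(\mathcal{A}_i)_{i\in\mathcal{N}},P,(R_i)_{i\in\mathcal{N}},\gamma\rangle$, where $\mathcal{N}=\{1,\ldots,N\}$ is the set of agents, $\mathcal{S}$ is the (continuous) state space, $\mathcal{A}_i\subset\mathbb{R}^q$ is agent $i$'s action set, $\boldsymbol{\mathcal{A}}=\times_{i=1}^N\mathcal{A}_i$, $P(s';\boldsymbol{a},s)$ is the density in $s'$ of the next state given current state $s$ and joint action $\boldsymbol{a}$, $R_i(s,\boldsymbol{a})\in\mathbb{R}$ is agent $i$'s (expected) reward, and $\gamma\in[0,1)$. For an agent $i$, a joint action is written $(a^i,a^{-i})$, where $a^{-i}$ collects the actions of all agents other than $i$; similarly $(\pi_i,\pi_{-i})$ for strategies. A Markov strategy of agent $i$ assigns to each state $s$ a probability distribution $\pi_i(\cdot|s)$ on $\mathcal{A}_i$; $\Pi_i$ is the (compact) space of Markov strategies of agent $i$ and $\boldsymbol{\Pi}=\times_{i\in\mathcal{N}}\Pi_i$. Agents randomise independently. The value function of agent $i$ is $v_i^{\boldsymbol{\pi}}(s)=\mathbb{E}[\sum_{t=0}^\infty\gamma^tR_i(s_t,\boldsymbol{a}_t)\mid s_0=s,\boldsymbol{a}_t\sim\boldsymbol{\pi}(\cdot|s_t)]$, with $s_{t+1}\sim P(\cdot;\boldsymbol{a}_t,s_t)$. A Markov perfect equilibrium is a profile $\boldsymbol{\hat{\pi}}\in\boldsymbol{\Pi}$ such that for all $i\in\mathcal{N}$,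 $s\in\mathcal{S}$, $\pi_i'\in\Pi_i$: $v_i^{(\hat\pi_i,\hat\pi_{-i})}(s)\ge v_i^{(\pi_i',\hat\pi_{-i})}(s)$. The game is a continuous stochastic potential game with potential $\phi$ if for all $i\in\mathcal{N}$, $s\in\mathcal{S}$ and $(a^i,a^{-i}),(a'^i,a^{-i})\in\boldsymbol{\mathcal{A}}$: $R_i(s,(a^i,a^{-i}))-R_i(s,(a'^i,a^{-i}))=\phi(s,(a^i,a^{-i}))-\phi(s,(a'^i,a^{-i}))$. Standing assumptions: state transitivity holds (with the same $\phi$), i.e. for all $i\in\mathcal{N}$, $s,s'\in\mathcal{S}$, $\boldsymbol{a}\in\boldsymbol{\mathcal{A}}$: $R_i(s,\boldsymbol{a})-R_i(s',\boldsymbol{a})=\phi(s,\boldsymbol{a})-\phi(s',\boldsymbol{a})$; each $R_i$ is bounded, measurable, and continuously differentiable in the state and action inputs. Dynamic potential function: $B^{\boldsymbol{\pi}}(s):=\mathbb{E}[\sum_{t=0}^\infty\gamma^t\phi(s_t,\boldsymbol{a}_t)\mid s_0=s,\boldsymbol{a}_t\sim\boldsymbol{\pi}(\cdot|s_t)]$. Bellman operator: for $g:\mathcal{S}\times\boldsymbol{\mathcal{A}}\to\mathbb{R}$ and $F:\mathcal{S}\to\mathbb{R}$, $[T_gF](s):=\sup_{\boldsymbol{a}\in\boldsymbol{\mathcal{A}}}\big[g(s,\boldsymbol{a})+\gamma\int_{\mathcal{S}}P(s';\boldsymbol{a},s)F(s')\,ds'\big]$; $T_g^k$ is its $k$-fold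 iterate. $\|\cdot\|$ denotes the supremum norm. The function $\phi_\epsilon$ is an approximation of $\phi$, and the superscript $\boldsymbol{\tilde\pi}$ in $B_\epsilon^{\boldsymbol{\tilde\pi}}$ is only notation for the limit function.
   Formalization: The clause that the iterates of the Bellman operator for φ started at B^π converge to the dynamic potential of π̂ is assumed, not derived: it fails for some Markov perfect equilibria (e.g. an inferior equilibrium of a coordination game), and the bound then fails too. *)

theory Defs
  imports "HOL-Probability.Probability"
begin

record ('s, 'a, 'n) game =
  states :: "'s set"
  actions :: "'n \<Rightarrow> 'a set"
  transition :: "'s \<Rightarrow> 'a^'n::finite \<Rightarrow> 's \<Rightarrow> real"  \<comment> \<open>\<open>transition G s' a s\<close> is \<open>P(s'; a, s)\<close>\<close>
  reward :: "'n \<Rightarrow> 's \<Rightarrow> 'a^'n::finite \<Rightarrow> real"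
  discount :: real

definition joint_actions :: "('s, 'a, 'n::finite) game \<Rightarrow> ('a^'n) set" where
  "joint_actions G = {a. \<forall>i. a $ i \<in> actions G i}"

definition deviate :: "'a^'n \<Rightarrow> 'n::finite \<Rightarrow> 'a \<Rightarrow> 'a^'n" where
  "deviate a i x = (\<chi> j. if j = i then x else a $ j)"

definition state_space :: "('s::euclidean_space, 'a, 'n::finite) game \<Rightarrow> 's measure" where
  "state_space G = restrict_space borel (states G)"

definition action_space :: "('s, 'a::euclidean_space, 'n::finite) game \<Rightarrow> ('a^'n) measure" where
  "action_space G = restrict_space borel (joint_actions G)"

definition continuous_stochastic_game ::
    "('s::euclidean_space, 'a::euclidean_space, 'n::finite) game \<Rightarrow> bool" where
  "continuous_stochastic_game G \<longleftrightarrow>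
     states G \<in> sets borel \<and> states G \<noteq> {} \<and>
     (\<forall>i. actions G i \<in> sets borel \<and> actions G i \<noteq> {}) \<and>
     (\<lambda>(s', a, s). transition G s' a s)
        \<in> borel_measurable (state_space G \<Otimes>\<^sub>M (action_space G \<Otimes>\<^sub>M state_space G)) \<and>
     (\<forall>s'\<in>states G. \<forall>a\<in>joint_actions G. \<forall>s\<in>states G. 0 \<le> transition G s' a s) \<and>
     (\<forall>a\<in>joint_actions G. \<forall>s\<in>states G.
        (\<integral>\<^sup>+ s'. ennreal (transition G s' a s) \<partial>restrict_space lborel (states G)) = 1) \<and>
     0 \<le> discount G \<and> discount G < 1"

definition is_potential ::
    "('s, 'a, 'n::finite) game \<Rightarrow> ('s \<Rightarrow> 'a^'n \<Rightarrow> real) \<Rightarrow> bool" where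
  "is_potential G \<phi> \<longleftrightarrow>
     (\<forall>i. \<forall>s\<in>states G. \<forall>a\<in>joint_actions G. \<forall>x\<in>actions G i.
        reward G i s a - reward G i s (deviate a i x) = \<phi> s a - \<phi> s (deviate a i x))"

definition state_transitive ::
    "('s, 'a, 'n::finite) game \<Rightarrow> ('s \<Rightarrow> 'a^'n \<Rightarrow> real) \<Rightarrow> bool" where
  "state_transitive G \<phi> \<longleftrightarrow>
     (\<forall>i. \<forall>s\<in>states G. \<forall>s'\<in>states G. \<forall>a\<in>joint_actions G.
        reward G i s a - reward G i s' a = \<phi> s a - \<phi> s' a)"

text \<open>The sets of states and actions need not be open, so derivatives are taken within the domain.\<close>

definition continuously_differentiable_on ::
    "('x::real_normed_vector \<Rightarrow> 'y::real_normed_vector) \<Rightarrow> 'x set \<Rightarrow> bool" where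
  "continuously_differentiable_on f X \<longleftrightarrow>
     (\<exists>f' :: 'x \<Rightarrow> 'x \<Rightarrow>\<^sub>L 'y. continuous_on X f' \<and>
        (\<forall>x\<in>X. (f has_derivative blinfun_apply (f' x)) (at x within X)))"

definition regular_rewards ::
    "('s::euclidean_space, 'a::euclidean_space, 'n::finite) game \<Rightarrow> bool" where
  "regular_rewards G \<longleftrightarrow>
     (\<forall>i. bounded ((\<lambda>(s, a). reward G i s a) ` (states G \<times> joint_actions G)) \<and>
          (\<lambda>(s, a). reward G i s a) \<in> borel_measurable (state_space G \<Otimes>\<^sub>M action_space G) \<and>
          continuously_differentiable_on (\<lambda>(s, a). reward G i s a) (states G \<times> joint_actions G))"

type_synonym ('s, 'a) strategy = "'s \<Rightarrow> 'a measure"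

definition strategies ::
    "('s::euclidean_space, 'a::euclidean_space, 'n::finite) game \<Rightarrow> 'n \<Rightarrow> ('s, 'a) strategy set" where
  "strategies G i = state_space G \<rightarrow>\<^sub>M prob_algebra (restrict_space borel (actions G i))"

definition profiles ::
    "('s::euclidean_space, 'a::euclidean_space, 'n::finite) game \<Rightarrow> ('n \<Rightarrow> ('s, 'a) strategy) set" where
  "profiles G = {\<pi>. \<forall>i. \<pi> i \<in> strategies G i}"

text \<open>Agents randomise independently: the joint action has the product distribution.\<close>

definition joint_strategy ::
    "('s, 'a::euclidean_space, 'n::finite) game \<Rightarrow> ('n \<Rightarrow> ('s, 'a) strategy) \<Rightarrow> 's \<Rightarrow> ('a^'n) measure" where
  "joint_strategy G \<pi> s = distr (\<Pi>\<^sub>M i\<in>UNIV. \<pi> i s) (action_space G) (\<lambda>x. \<chi> i. x i)"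

definition next_state ::
    "('s::euclidean_space, 'a, 'n::finite) game \<Rightarrow> 's \<Rightarrow> 'a^'n \<Rightarrow> 's measure" where
  "next_state G s a = density (restrict_space lborel (states G)) (\<lambda>s'. ennreal (transition G s' a s))"

text \<open>The law of \<open>(s, a)\<close> when \<open>s\<close> has law \<open>\<mu>\<close> and \<open>a\<close> is drawn from \<open>\<pi>(\<cdot>|s)\<close>.\<close>

definition draw_action ::
    "('s::euclidean_space, 'a::euclidean_space, 'n::finite) game \<Rightarrow> ('n \<Rightarrow> ('s, 'a) strategy) \<Rightarrow>
     's measure \<Rightarrow> ('s \<times> ('a^'n)) measure" where
  "draw_action G \<pi> \<mu> =
     \<mu> \<bind> (\<lambda>s. joint_strategy G \<pi> s \<bind> (\<lambda>a. return (state_space G \<Otimes>\<^sub>M action_space G) (s, a)))"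

text \<open>Conditional law of \<open>(s\<^sub>t, a\<^sub>t)\<close> given the history \<open>\<omega> k = (s\<^sub>k, a\<^sub>k)\<close>, \<open>k < t\<close>, with start state \<open>s\<close>.\<close>

primrec step_law ::
    "('s::euclidean_space, 'a::euclidean_space, 'n::finite) game \<Rightarrow> ('n \<Rightarrow> ('s, 'a) strategy) \<Rightarrow> 's \<Rightarrow>
     nat \<Rightarrow> (nat \<Rightarrow> 's \<times> ('a^'n)) \<Rightarrow> ('s \<times> ('a^'n)) measure" where
  "step_law G \<pi> s 0 \<omega> = draw_action G \<pi> (return (state_space G) s)"
| "step_law G \<pi> s (Suc t) \<omega> = draw_action G \<pi> (next_state G (fst (\<omega> t)) (snd (\<omega> t)))"

text \<open>The law of the whole trajectory \<open>(s\<^sub>t, a\<^sub>t)\<^sub>t\<close>: the Ionescu-Tulcea extension of these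
  conditional laws (its locale predicate is established below).\<close>

definition trajectory_law ::
    "('s::euclidean_space, 'a::euclidean_space, 'n::finite) game \<Rightarrow> ('n \<Rightarrow> ('s, 'a) strategy) \<Rightarrow> 's \<Rightarrow>
     (nat \<Rightarrow> 's \<times> ('a^'n)) measure" where
  "trajectory_law G \<pi> s =
     projective_family.lim UNIV
       (Ionescu_Tulcea.CI (step_law G \<pi> s) (\<lambda>_. state_space G \<Otimes>\<^sub>M action_space G))
       (\<lambda>_. state_space G \<Otimes>\<^sub>M action_space G)"

lemma vec_lambda_measurable:
  fixes G :: "('s::euclidean_space, 'a::euclidean_space, 'n::finite) game"
  shows "(\<lambda>x. \<chi> i. x i) \<in> (\<Pi>\<^sub>M i\<in>UNIV. restrict_space borel (actions G i)) \<rightarrow>\<^sub>M action_space G"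
  unfolding action_space_def
proof (rule measurable_restrict_space2)
  show "(\<lambda>x. \<chi> i. x i) \<in> space (\<Pi>\<^sub>M i\<in>UNIV. restrict_space borel (actions G i)) \<rightarrow> joint_actions G"
    by (auto simp: space_PiM joint_actions_def PiE_iff space_restrict_space)
  show "(\<lambda>x. \<chi> i. x i) \<in> (\<Pi>\<^sub>M i\<in>UNIV. restrict_space borel (actions G i)) \<rightarrow>\<^sub>M (borel :: ('a^'n) measure)"
  proof (subst borel_measurable_euclidean_space, intro ballI)
    fix b :: "'a^'n" assume "b \<in> Basis"
    have "(\<lambda>x. x i) \<in> (\<Pi>\<^sub>M i\<in>UNIV. restrict_space borel (actions G i)) \<rightarrow>\<^sub>M borel" for i
    proof (rule measurable_compose[OF measurable_component_singleton[of i UNIV]])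
      show "(\<lambda>x. x) \<in> restrict_space borel (actions G i) \<rightarrow>\<^sub>M borel" by (rule measurable_restrict_space1) simp
    qed simp
    then show "(\<lambda>x. (\<chi> i. x i) \<bullet> b) \<in> borel_measurable (\<Pi>\<^sub>M i\<in>UNIV. restrict_space borel (actions G i))"
      unfolding inner_vec_def by (intro borel_measurable_sum borel_measurable_inner) auto
  qed
qed

lemma PiM_kernel:
  fixes M :: "'i::finite \<Rightarrow> 'b measure"
  assumes p: "\<And>i. p i \<in> N \<rightarrow>\<^sub>M prob_algebra (M i)"
  shows "(\<lambda>s. \<Pi>\<^sub>M i\<in>UNIV. p i s) \<in> N \<rightarrow>\<^sub>M prob_algebra (\<Pi>\<^sub>M i\<in>UNIV. M i)"
proof (rule measurable_prob_algebra_generated[OF sets_PiM Int_stable_prod_algebra prod_algebra_sets_into_space])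
  fix s assume s: "s \<in> space N"
  have q: "prob_space (p i s)" "sets (p i s) = sets (M i)" for i
    using measurable_space[OF p s, of i] by (auto simp: space_prob_algebra)
  then show "prob_space (\<Pi>\<^sub>M i\<in>UNIV. p i s)" by (intro prob_space_PiM)
  show "sets (\<Pi>\<^sub>M i\<in>UNIV. p i s) = sets (\<Pi>\<^sub>M i\<in>UNIV. M i)"
    by (intro sets_PiM_cong) (auto simp: q)
next
  fix A assume "A \<in> prod_algebra UNIV M"
  then obtain X where X: "A = (\<Pi>\<^sub>E i\<in>UNIV. X i)" "\<And>i. X i \<in> sets (M i)"
    by (auto simp: prod_algebra_eq_finite)
  have "emeasure (\<Pi>\<^sub>M i\<in>UNIV. p i s) A = (\<Prod>i\<in>UNIV. emeasure (p i s) (X i))" if s: "s \<in> space N" for s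
  proof -
    have q: "prob_space (p i s)" "sets (p i s) = sets (M i)" for i
      using measurable_space[OF p s, of i] by (auto simp: space_prob_algebra)
    interpret product_sigma_finite "\<lambda>i. p i s"
      using q(1) by (intro product_sigma_finite.intro prob_space_imp_sigma_finite)
    show ?thesis unfolding X(1) by (rule emeasure_PiM) (simp_all add: X(2) q(2))
  qed
  moreover have "(\<lambda>s. \<Prod>i\<in>UNIV. emeasure (p i s) (X i)) \<in> borel_measurable N"
    by (intro borel_measurable_prod_ennreal measurable_compose[OF measurable_prob_algebraD[OF p] measurable_emeasure_subprob_algebra] X)
  ultimately show "(\<lambda>s. emeasure (\<Pi>\<^sub>M i\<in>UNIV. p i s) A) \<in> borel_measurable N"
    by (simp cong: measurable_cong)
qed

lemma joint_strategy_kernel: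
  fixes G :: "('s::euclidean_space, 'a::euclidean_space, 'n::finite) game"
  assumes "\<pi> \<in> profiles G"
  shows "joint_strategy G \<pi> \<in> state_space G \<rightarrow>\<^sub>M prob_algebra (action_space G)"
proof -
  have "(\<lambda>s. \<Pi>\<^sub>M i\<in>UNIV. \<pi> i s) \<in> state_space G \<rightarrow>\<^sub>M prob_algebra (\<Pi>\<^sub>M i\<in>UNIV. restrict_space borel (actions G i))"
    by (rule PiM_kernel) (use assms in \<open>auto simp: profiles_def strategies_def\<close>)
  then show ?thesis unfolding joint_strategy_def[abs_def]
    by (rule measurable_compose[OF _ measurable_distr_prob_space[OF vec_lambda_measurable]])
qed

lemma next_state_kernel:
  fixes G :: "('s::euclidean_space, 'a::euclidean_space, 'n::finite) game"
  assumes G: "continuous_stochastic_game G"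
  shows "(\<lambda>(s, a). next_state G s a) \<in> state_space G \<Otimes>\<^sub>M action_space G \<rightarrow>\<^sub>M prob_algebra (state_space G)"
proof -
  let ?L = "restrict_space lborel (states G)"
  have S: "states G \<in> sets borel" using G by (simp add: continuous_stochastic_game_def)
  have sL: "sets ?L = sets (state_space G)" by (simp add: state_space_def sets_restrict_space)
  have spL: "space ?L = states G" by (simp add: space_restrict_space)
  have spS: "space (state_space G) = states G" by (simp add: state_space_def space_restrict_space)
  have spA: "space (action_space G) = joint_actions G" by (simp add: action_space_def space_restrict_space)
  interpret sigma_finite_measure ?L
    by (rule sigma_finite_measure_restrict_space) (use S in \<open>auto intro: lborel.sigma_finite_measure_axioms\<close>)
  have tm: "(\<lambda>(s', a, s). transition G s' a s)
        \<in> borel_measurable (state_space G \<Otimes>\<^sub>M (action_space G \<Otimes>\<^sub>M state_space G))"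
    using G by (simp add: continuous_stochastic_game_def)
  have t: "(\<lambda>(x, s'). ennreal (transition G s' (snd x) (fst x))) \<in> borel_measurable ((state_space G \<Otimes>\<^sub>M action_space G) \<Otimes>\<^sub>M state_space G)"
  proof -
    have "(\<lambda>(x, s'). (s', snd x, fst x)) \<in> (state_space G \<Otimes>\<^sub>M action_space G) \<Otimes>\<^sub>M state_space G \<rightarrow>\<^sub>M state_space G \<Otimes>\<^sub>M (action_space G \<Otimes>\<^sub>M state_space G)"
      by measurable
    from measurable_compose[OF measurable_compose[OF this tm] measurable_ennreal]
    show ?thesis by (simp add: split_beta')
  qed
  have m1: "(\<lambda>s'. ennreal (transition G s' a s)) \<in> borel_measurable ?L" if "s \<in> states G" "a \<in> joint_actions G" for s a
  proof -
    have "(\<lambda>s'. ((s, a), s')) \<in> state_space G \<rightarrow>\<^sub>M (state_space G \<Otimes>\<^sub>M action_space G) \<Otimes>\<^sub>M state_space G"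
      using that by (intro measurable_Pair) (auto simp: spS spA)
    from measurable_compose[OF this t] show ?thesis
      by (simp cong: measurable_cong_sets add: sL)
  qed
  have ps: "prob_space (next_state G (fst x) (snd x))" if "x \<in> space (state_space G \<Otimes>\<^sub>M action_space G)" for x
  proof -
    have x: "fst x \<in> states G" "snd x \<in> joint_actions G" using that by (auto simp: space_pair_measure spS spA)
    have "emeasure (next_state G (fst x) (snd x)) (states G) = (\<integral>\<^sup>+ s'. ennreal (transition G s' (snd x) (fst x)) \<partial>?L)"
      unfolding next_state_def using x S
      by (subst emeasure_density) (auto intro!: m1 nn_integral_cong simp: spL sets_restrict_space split: split_indicator)
    then show ?thesis
      using G x by (intro prob_spaceI) (auto simp: continuous_stochastic_game_def next_state_def spL)
  qed
  show ?thesis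
  proof (rule measurable_prob_algebraI)
    show "prob_space (case x of (s, a) \<Rightarrow> next_state G s a)"
      if "x \<in> space (state_space G \<Otimes>\<^sub>M action_space G)" for x
      using ps[OF that] by (simp add: split_beta)
  next
    show "(\<lambda>(s, a). next_state G s a) \<in> state_space G \<Otimes>\<^sub>M action_space G \<rightarrow>\<^sub>M subprob_algebra (state_space G)"
    proof (rule measurable_subprob_algebra)
      fix x assume "x \<in> space (state_space G \<Otimes>\<^sub>M action_space G)"
      from ps[OF this] show "subprob_space (case x of (s, a) \<Rightarrow> next_state G s a)"
        by (simp add: split_beta prob_space_imp_subprob_space)
      show "sets (case x of (s, a) \<Rightarrow> next_state G s a) = sets (state_space G)"
        by (simp add: split_beta next_state_def sL)
    next
      fix A assume A: "A \<in> sets (state_space G)"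
      have "(\<lambda>x. \<integral>\<^sup>+ s'. ennreal (transition G s' (snd x) (fst x)) * indicator A s' \<partial>?L) \<in> borel_measurable (state_space G \<Otimes>\<^sub>M action_space G)"
      proof (rule borel_measurable_nn_integral)
        have e: "sets ((state_space G \<Otimes>\<^sub>M action_space G) \<Otimes>\<^sub>M ?L) = sets ((state_space G \<Otimes>\<^sub>M action_space G) \<Otimes>\<^sub>M state_space G)"
          by (intro sets_pair_measure_cong) (auto simp: sL)
        note t[measurable] A[measurable]
        have "(\<lambda>y. (case y of (x, s') \<Rightarrow> ennreal (transition G s' (snd x) (fst x))) * indicator A (snd y)) \<in> borel_measurable ((state_space G \<Otimes>\<^sub>M action_space G) \<Otimes>\<^sub>M state_space G)"
          by measurable
        then show "(\<lambda>(x, s'). ennreal (transition G s' (snd x) (fst x)) * indicator A s') \<in> borel_measurable ((state_space G \<Otimes>\<^sub>M action_space G) \<Otimes>\<^sub>M ?L)"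
          by (subst measurable_cong_sets[OF e refl]) (simp add: split_beta')
      qed
      moreover have "emeasure (case x of (s, a) \<Rightarrow> next_state G s a) A = (\<integral>\<^sup>+ s'. ennreal (transition G s' (snd x) (fst x)) * indicator A s' \<partial>?L)"
        if "x \<in> space (state_space G \<Otimes>\<^sub>M action_space G)" for x
        using that A unfolding next_state_def split_beta
        by (subst emeasure_density) (auto intro!: m1 simp: sL space_pair_measure spS spA)
      ultimately show "(\<lambda>x. emeasure (case x of (s, a) \<Rightarrow> next_state G s a) A) \<in> borel_measurable (state_space G \<Otimes>\<^sub>M action_space G)"
        by (simp cong: measurable_cong)
    qed
  qed
qed

lemma draw_action_kernel:
  assumes "\<pi> \<in> profiles G"
  shows "draw_action G \<pi> \<in> prob_algebra (state_space G) \<rightarrow>\<^sub>M prob_algebra (state_space G \<Otimes>\<^sub>M action_space G)"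
proof -
  let ?M = "state_space G \<Otimes>\<^sub>M action_space G"
  have "(\<lambda>s. joint_strategy G \<pi> s \<bind> (\<lambda>a. return ?M (s, a))) \<in> state_space G \<rightarrow>\<^sub>M prob_algebra ?M"
  proof (rule measurable_bind_prob_space2[OF joint_strategy_kernel[OF assms]])
    have "return ?M \<in> ?M \<rightarrow>\<^sub>M prob_algebra ?M" by (rule measurable_return_prob_space)
    then show "(\<lambda>(s, a). return ?M (s, a)) \<in> ?M \<rightarrow>\<^sub>M prob_algebra ?M" by simp
  qed
  then show ?thesis unfolding draw_action_def[abs_def]
    by (rule measurable_bind_prob_space[OF measurable_ident_sets[OF refl]])
qed

lemma ionescu_tulcea_step_law:
  fixes G :: "('s::euclidean_space, 'a::euclidean_space, 'n::finite) game"
  assumes G: "continuous_stochastic_game G" and \<pi>: "\<pi> \<in> profiles G" and s: "s \<in> states G"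
  shows "Ionescu_Tulcea (step_law G \<pi> s) (\<lambda>_. state_space G \<Otimes>\<^sub>M action_space G)"
proof -
  let ?M = "state_space G \<Otimes>\<^sub>M action_space G"
  have *: "step_law G \<pi> s t \<in> PiM {0..<t} (\<lambda>_. ?M) \<rightarrow>\<^sub>M prob_algebra ?M" for t
  proof (cases t)
    case 0
    have "return (state_space G) s \<in> space (prob_algebra (state_space G))"
      using s by (auto simp: space_prob_algebra prob_space_return state_space_def space_restrict_space)
    then have "draw_action G \<pi> (return (state_space G) s) \<in> space (prob_algebra ?M)"
      by (rule measurable_space[OF draw_action_kernel[OF \<pi>]])
    moreover have "step_law G \<pi> s 0 = (\<lambda>_. draw_action G \<pi> (return (state_space G) s))"
      by (simp add: fun_eq_iff)
    ultimately show ?thesis using 0 by simp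
  next
    case (Suc k)
    have "(\<lambda>\<omega>. \<omega> k) \<in> PiM {0..<t} (\<lambda>_. ?M) \<rightarrow>\<^sub>M ?M"
      using Suc by (intro measurable_component_singleton) auto
    from measurable_compose[OF measurable_compose[OF this next_state_kernel[OF G]] draw_action_kernel[OF \<pi>]]
    have "(\<lambda>\<omega>. draw_action G \<pi> (next_state G (fst (\<omega> k)) (snd (\<omega> k)))) \<in> PiM {0..<t} (\<lambda>_. ?M) \<rightarrow>\<^sub>M prob_algebra ?M"
      by (simp add: split_beta')
    moreover have "step_law G \<pi> s t = (\<lambda>\<omega>. draw_action G \<pi> (next_state G (fst (\<omega> k)) (snd (\<omega> k))))"
      by (simp add: fun_eq_iff Suc)
    ultimately show ?thesis by simp
  qed
  show ?thesis
  proof (rule Ionescu_Tulcea.intro)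
    show "step_law G \<pi> s t \<in> PiM {0..<t} (\<lambda>_. ?M) \<rightarrow>\<^sub>M subprob_algebra ?M" for t
      by (rule measurable_prob_algebraD[OF *])
    show "prob_space (step_law G \<pi> s t \<omega>)" if "\<omega> \<in> space (PiM {0..<t} (\<lambda>_. ?M))" for t \<omega>
      using measurable_space[OF * that] by (simp add: space_prob_algebra)
  qed
qed

definition expected_discounted_sum ::
    "('s::euclidean_space, 'a::euclidean_space, 'n::finite) game \<Rightarrow> ('s \<Rightarrow> 'a^'n \<Rightarrow> real) \<Rightarrow>
     ('n \<Rightarrow> ('s, 'a) strategy) \<Rightarrow> 's \<Rightarrow> real" where
  "expected_discounted_sum G g \<pi> s =
     (\<integral>\<omega>. (\<Sum>t. discount G ^ t * g (fst (\<omega> t)) (snd (\<omega> t))) \<partial>trajectory_law G \<pi> s)"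

definition value_function ::
    "('s::euclidean_space, 'a::euclidean_space, 'n::finite) game \<Rightarrow> 'n \<Rightarrow>
     ('n \<Rightarrow> ('s, 'a) strategy) \<Rightarrow> 's \<Rightarrow> real" where
  "value_function G i = expected_discounted_sum G (reward G i)"

definition dynamic_potential ::
    "('s::euclidean_space, 'a::euclidean_space, 'n::finite) game \<Rightarrow> ('s \<Rightarrow> 'a^'n \<Rightarrow> real) \<Rightarrow>
     ('n \<Rightarrow> ('s, 'a) strategy) \<Rightarrow> 's \<Rightarrow> real" where
  "dynamic_potential G \<phi> = expected_discounted_sum G \<phi>"

definition markov_perfect_equilibrium ::
    "('s::euclidean_space, 'a::euclidean_space, 'n::finite) game \<Rightarrow>
     ('n \<Rightarrow> ('s, 'a) strategy) \<Rightarrow> bool" where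
  "markov_perfect_equilibrium G \<pi> \<longleftrightarrow> \<pi> \<in> profiles G \<and>
     (\<forall>i. \<forall>s\<in>states G. \<forall>\<pi>'\<in>strategies G i.
        value_function G i (\<pi>(i := \<pi>')) s \<le> value_function G i \<pi> s)"

text \<open>The Lebesgue integral, with the upper integral in place of the default value \<open>0\<close> on functions
  that are not integrable: a supremum over an uncountable action set need not be measurable, and
  with the default value the Bellman operator would not even be monotone there. On integrable
  functions the upper integral agrees with the Lebesgue integral.\<close>

definition upper_integral :: "'x measure \<Rightarrow> ('x \<Rightarrow> real) \<Rightarrow> real" where
  "upper_integral M f = Inf {integral\<^sup>L M h | h. integrable M h \<and> (\<forall>x\<in>space M. f x \<le> h x)}"

definition lebesgue_or_upper_integral :: "'x measure \<Rightarrow> ('x \<Rightarrow> real) \<Rightarrow> real" where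
  "lebesgue_or_upper_integral M f = (if integrable M f then integral\<^sup>L M f else upper_integral M f)"

lemma upper_integral_eq_integral:
  assumes "integrable M f"
  shows "upper_integral M f = integral\<^sup>L M f"
  unfolding upper_integral_def
  by (rule cInf_eq_minimum) (use assms in \<open>auto intro!: integral_mono\<close>)

definition bellman ::
    "('s::euclidean_space, 'a, 'n::finite) game \<Rightarrow> ('s \<Rightarrow> 'a^'n \<Rightarrow> real) \<Rightarrow> ('s \<Rightarrow> real) \<Rightarrow> 's \<Rightarrow> real" where
  "bellman G g F s =
     (SUP a\<in>joint_actions G. g s a + discount G *
        lebesgue_or_upper_integral (lebesgue_on (states G)) (\<lambda>s'. transition G s' a s * F s'))"

definition bellman_limit ::
    "('s::euclidean_space, 'a, 'n::finite) game \<Rightarrow> ('s \<Rightarrow> 'a^'n \<Rightarrow> real) \<Rightarrow> ('s \<Rightarrow> real) \<Rightarrow> 's \<Rightarrow> real" where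
  "bellman_limit G g F s = lim (\<lambda>k. (bellman G g ^^ k) F s)"

text \<open>Extended-real valued, so that it is \<open>\<infinity>\<close> (not an unspecified real) on unbounded functions.\<close>

definition sup_norm :: "'x set \<Rightarrow> ('x \<Rightarrow> real) \<Rightarrow> ereal" where
  "sup_norm X f = (SUP x\<in>X. ereal \<bar>f x\<bar>)"

end

theory Submission
  imports Defs
begin

text \<open>The Bellman operator of a bounded payoff \<open>g\<close> is a \<open>\<gamma>\<close>-contraction on bounded functions, and
  changing \<open>g\<close> by at most \<open>\<epsilon>\<close> changes it by at most \<open>\<epsilon>\<close>. Hence the \<open>k\<close>-th iterates for \<open>\<phi>\<close> and
  \<open>\<phi>\<^sub>\<epsilon>\<close> with a common starting function differ by at most \<open>\<epsilon> (1 + \<gamma> + \<dots> + \<gamma>\<^sup>k\<^sup>-\<^sup>1)\<close>, so the limits differ by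
  at most \<open>\<epsilon> / (1 - \<gamma>)\<close>, which is below the claimed bound. The potential is bounded because it inherits its
  increments from the bounded rewards, along any change of state and, one agent at a time, along
  any change of joint action.\<close>

section \<open>Bounded functions and upper integrals\<close>

lemma bounded_case_prod_image_iff:
  fixes g :: "'x \<Rightarrow> 'y \<Rightarrow> real"
  shows "bounded ((\<lambda>(x, y). g x y) ` (X \<times> Y)) \<longleftrightarrow> (\<exists>D. \<forall>x\<in>X. \<forall>y\<in>Y. \<bar>g x y\<bar> \<le> D)"
  unfolding bounded_iff by (intro iff_exI) auto

text \<open>Both branches of the definition agree on integrable functions. All estimates can
  therefore be made with the infimum over integrable majorants, with no measurability of the
  function integrated.\<close>

lemma lebesgue_or_upper_integral_eq_upper: "lebesgue_or_upper_integral M f = upper_integral M f"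
  by (simp add: lebesgue_or_upper_integral_def upper_integral_eq_integral)

text \<open>If \<open>h\<close> is an integrable majorant of \<open>t * F'\<close>, then
  \<open>h + t * c\<close> is one of \<open>t * F\<close>, and its integral is larger by exactly
  \<open>c\<close> because \<open>t\<close> has integral 1. Boundedness of \<open>F\<close> and
  \<open>F'\<close> keeps the real infima meaningful.\<close>

lemma upper_integral_density_le:
  fixes t :: "'x \<Rightarrow> real"
  assumes t: "integrable M t" "integral\<^sup>L M t = 1" "\<And>x. x \<in> space M \<Longrightarrow> 0 \<le> t x"
    and F: "bounded (F ` space M)" and F': "bounded (F' ` space M)"
    and le: "\<And>x. x \<in> space M \<Longrightarrow> F x \<le> F' x + c"
  shows "upper_integral M (\<lambda>x. t x * F x) \<le> upper_integral M (\<lambda>x. t x * F' x) + c"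
proof -
  define H where "H f = {integral\<^sup>L M h | h. integrable M h \<and> (\<forall>x\<in>space M. f x \<le> h x)}" for f :: "'x \<Rightarrow> real"
  obtain C where C: "\<And>x. x \<in> space M \<Longrightarrow> \<bar>F x\<bar> \<le> C"
    using F by (auto simp: bounded_iff)
  obtain C' where C': "\<And>x. x \<in> space M \<Longrightarrow> \<bar>F' x\<bar> \<le> C'"
    using F' by (auto simp: bounded_iff)
  \<comment> \<open>\<open>Inf\<close> of an empty set of reals is unspecified; the multiple
    \<open>t * C'\<close> of the density is an integrable majorant.\<close>
  have "t x * F' x \<le> t x * C'" if "x \<in> space M" for x
    using C'[OF that] t(3)[OF that] by (intro mult_left_mono) auto
  then have ne: "H (\<lambda>x. t x * F' x) \<noteq> {}"
    using t(1) unfolding H_def by (auto intro!: exI[of _ "\<lambda>x. t x * C'"])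
  \<comment> \<open>Every majorant of \<open>t * F\<close> dominates \<open>t * - C\<close>, so its
    integral is at least \<open>- C\<close>.\<close>
  have bdd: "bdd_below (H (\<lambda>x. t x * F x))"
  proof (rule bdd_belowI)
    fix y assume "y \<in> H (\<lambda>x. t x * F x)"
    then obtain h where h: "integrable M h" "\<And>x. x \<in> space M \<Longrightarrow> t x * F x \<le> h x" "y = integral\<^sup>L M h"
      by (auto simp: H_def)
    have "(\<integral>x. t x * - C \<partial>M) \<le> integral\<^sup>L M h"
    proof (rule integral_mono)
      fix x assume x: "x \<in> space M"
      have "t x * - C \<le> t x * F x"
        using C[OF x] t(3)[OF x] by (intro mult_left_mono) auto
      then show "t x * - C \<le> h x" using h(2)[OF x] by simp
    qed (use t h in auto)
    then show "(\<integral>x. t x * - C \<partial>M) \<le> y" by (simp add: h)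
  qed
  have "upper_integral M (\<lambda>x. t x * F x) - c \<le> Inf (H (\<lambda>x. t x * F' x))"
  proof (rule cInf_greatest[OF ne])
    fix y assume "y \<in> H (\<lambda>x. t x * F' x)"
    then obtain h where h: "integrable M h" "\<And>x. x \<in> space M \<Longrightarrow> t x * F' x \<le> h x" "y = integral\<^sup>L M h"
      by (auto simp: H_def)
    have "t x * F x \<le> h x + t x * c" if x: "x \<in> space M" for x
      using mult_left_mono[OF le[OF x] t(3)[OF x]] h(2)[OF x] by (simp add: distrib_left)
    then have "(\<integral>x. h x + t x * c \<partial>M) \<in> H (\<lambda>x. t x * F x)"
      using h(1) t(1) unfolding H_def by (auto intro!: exI[of _ "\<lambda>x. h x + t x * c"])
    from cInf_lower[OF this bdd] show "upper_integral M (\<lambda>x. t x * F x) - c \<le> y"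
      using h t by (simp add: upper_integral_def H_def)
  qed
  then show ?thesis by (simp add: upper_integral_def H_def)
qed

section \<open>Expectations under the transition density\<close>

lemma joint_actions_nonempty:
  assumes "continuous_stochastic_game G"
  shows "joint_actions G \<noteq> {}"
proof -
  have "\<forall>i. \<exists>x. x \<in> actions G i" using assms by (auto simp: continuous_stochastic_game_def)
  then obtain f where "\<And>i. f i \<in> actions G i" by metis
  then have "(\<chi> i. f i) \<in> joint_actions G" by (simp add: joint_actions_def)
  then show ?thesis by blast
qed

text \<open>The game is specified with Borel sets and \<open>lborel\<close>, while
  \<open>bellman\<close> integrates against the completed measure. Completion preserves Borel
  measurability and leaves the nonnegative integral unchanged.\<close>

lemma transition_lebesgue_density:
  fixes G :: "('s::euclidean_space, 'a::euclidean_space, 'n::finite) game"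
  assumes G: "continuous_stochastic_game G" and a: "a \<in> joint_actions G" and s: "s \<in> states G"
  shows "integrable (lebesgue_on (states G)) (\<lambda>s'. transition G s' a s)"
    and "(\<integral>s'. transition G s' a s \<partial>lebesgue_on (states G)) = 1"
proof -
  let ?t = "\<lambda>s'. transition G s' a s"
  have S: "states G \<in> sets borel" using G by (simp add: continuous_stochastic_game_def)
  have "(\<lambda>s'. (s', a, s)) \<in> state_space G \<rightarrow>\<^sub>M state_space G \<Otimes>\<^sub>M (action_space G \<Otimes>\<^sub>M state_space G)"
    using a s by (intro measurable_Pair) (auto simp: state_space_def action_space_def space_restrict_space)
  moreover have "(\<lambda>(s', a, s). transition G s' a s)
      \<in> borel_measurable (state_space G \<Otimes>\<^sub>M (action_space G \<Otimes>\<^sub>M state_space G))"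
    using G by (simp add: continuous_stochastic_game_def)
  ultimately have "(\<lambda>s'. (\<lambda>(s', a, s). transition G s' a s) (s', a, s)) \<in> borel_measurable (state_space G)"
    by (rule measurable_compose)
  then have "?t \<in> borel_measurable (restrict_space lborel (states G))"
    by (simp add: state_space_def cong: measurable_cong_sets sets_restrict_space_cong)
  \<comment> \<open>Extension by zero to the whole space, where the passage to the completion is
    available; the result is then restricted again.\<close>
  then have "(\<lambda>s'. indicator (states G) s' *\<^sub>R ?t s') \<in> borel_measurable lborel"
    by (subst (asm) borel_measurable_restrict_space_iff) (use S in auto)
  from measurable_completion[OF this] have m: "?t \<in> borel_measurable (lebesgue_on (states G))"
    by (subst borel_measurable_restrict_space_iff) (use S in auto)
  have "(\<integral>\<^sup>+ s'. ennreal (?t s') \<partial>lebesgue_on (states G))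
      = (\<integral>\<^sup>+ s'. ennreal (?t s') \<partial>restrict_space lborel (states G))"
    using S by (simp add: nn_integral_restrict_space nn_integral_completion)
  also have "\<dots> = ennreal 1" using G a s by (simp add: continuous_stochastic_game_def)
  finally have "integrable (lebesgue_on (states G)) ?t \<and> integral\<^sup>L (lebesgue_on (states G)) ?t = 1"
    by (subst (asm) nn_integral_eq_integrable[OF m])
       (use G a s in \<open>auto simp: continuous_stochastic_game_def space_restrict_space intro!: AE_I2\<close>)
  then show "integrable (lebesgue_on (states G)) ?t" "integral\<^sup>L (lebesgue_on (states G)) ?t = 1" by auto
qed

lemma expected_next_le:
  fixes G :: "('s::euclidean_space, 'a::euclidean_space, 'n::finite) game"
  assumes G: "continuous_stochastic_game G" and a: "a \<in> joint_actions G" and s: "s \<in> states G"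
    and F: "bounded (F ` states G)" and F': "bounded (F' ` states G)"
    and le: "\<And>s'. s' \<in> states G \<Longrightarrow> F s' \<le> F' s' + c"
  shows "lebesgue_or_upper_integral (lebesgue_on (states G)) (\<lambda>s'. transition G s' a s * F s')
    \<le> lebesgue_or_upper_integral (lebesgue_on (states G)) (\<lambda>s'. transition G s' a s * F' s') + c"
  unfolding lebesgue_or_upper_integral_eq_upper
  by (rule upper_integral_density_le[OF transition_lebesgue_density[OF G a s]])
     (use G a s F F' le in \<open>auto simp: continuous_stochastic_game_def space_restrict_space\<close>)

section \<open>One step of the Bellman operator\<close>

lemma bellman_bdd_above:
  fixes G :: "('s::euclidean_space, 'a::euclidean_space, 'n::finite) game"
  assumes G: "continuous_stochastic_game G" and s: "s \<in> states G"
    and g: "bounded ((\<lambda>(s, a). g s a) ` (states G \<times> joint_actions G))"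
    and F: "bounded (F ` states G)"
  shows "bdd_above ((\<lambda>a. g s a + discount G *
    lebesgue_or_upper_integral (lebesgue_on (states G)) (\<lambda>s'. transition G s' a s * F s')) ` joint_actions G)"
proof -
  obtain D where D: "\<And>a. a \<in> joint_actions G \<Longrightarrow> \<bar>g s a\<bar> \<le> D"
    using g s unfolding bounded_case_prod_image_iff by blast
  obtain C where C: "\<And>s. s \<in> states G \<Longrightarrow> \<bar>F s\<bar> \<le> C" using F by (auto simp: bounded_iff)
  have \<gamma>: "0 \<le> discount G" using G by (simp add: continuous_stochastic_game_def)
  have "lebesgue_or_upper_integral (lebesgue_on (states G)) (\<lambda>s'. transition G s' a s * F s') \<le> C"
    if a: "a \<in> joint_actions G" for a
  proof -
    \<comment> \<open>Comparison of \<open>F\<close> with the zero function, whose expectation is 0,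
      turns the shift \<open>C\<close> into an upper bound. It is uniform in the action, as needed
      for the real supremum to be a genuine one.\<close>
    have "bounded ((\<lambda>_. 0 :: real) ` states G)" by (auto simp: bounded_iff)
    from expected_next_le[OF G a s F this, of C] show ?thesis
      using C by (force simp: lebesgue_or_upper_integral_def abs_le_iff)
  qed
  then have "g s a + discount G * lebesgue_or_upper_integral (lebesgue_on (states G))
      (\<lambda>s'. transition G s' a s * F s') \<le> D + discount G * C" if "a \<in> joint_actions G" for a
    using D[OF that] \<gamma> that by (intro add_mono mult_left_mono) auto
  then show ?thesis by (intro bdd_aboveI2)
qed

text \<open>The estimate is one-sided so that only upper bounds of suprema are needed: each action
  is compared separately, and the right-hand side is then bounded by its own supremum.\<close>

lemma bellman_le:
  fixes G :: "('s::euclidean_space, 'a::euclidean_space, 'n::finite) game"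
  assumes G: "continuous_stochastic_game G" and s: "s \<in> states G"
    and g': "bounded ((\<lambda>(s, a). g' s a) ` (states G \<times> joint_actions G))"
    and F: "bounded (F ` states G)" and F': "bounded (F' ` states G)"
    and g_le: "\<And>a. a \<in> joint_actions G \<Longrightarrow> g s a \<le> g' s a + d"
    and F_le: "\<And>s. s \<in> states G \<Longrightarrow> F s \<le> F' s + c"
  shows "bellman G g F s \<le> bellman G g' F' s + (d + discount G * c)"
  unfolding bellman_def[of G g]
proof (rule cSUP_least[OF joint_actions_nonempty[OF G]])
  fix a assume a: "a \<in> joint_actions G"
  let ?E = "\<lambda>F. lebesgue_or_upper_integral (lebesgue_on (states G)) (\<lambda>s'. transition G s' a s * F s')"
  have \<gamma>: "0 \<le> discount G" using G by (simp add: continuous_stochastic_game_def)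
  have "g s a + discount G * ?E F \<le> (g' s a + d) + discount G * (?E F' + c)"
    using expected_next_le[OF G a s F F' F_le] g_le[OF a] \<gamma>
    by (intro add_mono mult_left_mono) auto
  also have "\<dots> = (g' s a + discount G * ?E F') + (d + discount G * c)" by (simp add: algebra_simps)
  also have "g' s a + discount G * ?E F' \<le> bellman G g' F' s"
    unfolding bellman_def by (rule cSUP_upper[OF a bellman_bdd_above[OF G s g' F']])
  finally show "g s a + discount G * ?E F \<le> bellman G g' F' s + (d + discount G * c)" by simp
qed

text \<open>Swapping the two sides in \<open>bellman_le\<close> gives both directions. The case
  \<open>d = 0\<close> is the contraction property, the case \<open>c = 0\<close> the stability
  under a change of payoff.\<close>

lemma bellman_abs_diff_le:
  fixes G :: "('s::euclidean_space, 'a::euclidean_space, 'n::finite) game"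
  assumes G: "continuous_stochastic_game G" and s: "s \<in> states G"
    and g: "bounded ((\<lambda>(s, a). g s a) ` (states G \<times> joint_actions G))"
    and g': "bounded ((\<lambda>(s, a). g' s a) ` (states G \<times> joint_actions G))"
    and F: "bounded (F ` states G)" and F': "bounded (F' ` states G)"
    and d: "\<And>a. a \<in> joint_actions G \<Longrightarrow> \<bar>g s a - g' s a\<bar> \<le> d"
    and c: "\<And>s. s \<in> states G \<Longrightarrow> \<bar>F s - F' s\<bar> \<le> c"
  shows "\<bar>bellman G g F s - bellman G g' F' s\<bar> \<le> d + discount G * c"
proof -
  have "bellman G g F s \<le> bellman G g' F' s + (d + discount G * c)"
    by (rule bellman_le[OF G s g' F F']) (use d c in \<open>simp_all add: abs_le_iff algebra_simps\<close>)
  moreover have "bellman G g' F' s \<le> bellman G g F s + (d + discount G * c)"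
    by (rule bellman_le[OF G s g F' F]) (use d c in \<open>simp_all add: abs_le_iff algebra_simps\<close>)
  ultimately show ?thesis by (simp add: abs_le_iff)
qed

lemma bounded_bellman:
  fixes G :: "('s::euclidean_space, 'a::euclidean_space, 'n::finite) game"
  assumes G: "continuous_stochastic_game G"
    and g: "bounded ((\<lambda>(s, a). g s a) ` (states G \<times> joint_actions G))"
    and F: "bounded (F ` states G)"
  shows "bounded (bellman G g F ` states G)"
proof -
  obtain D where D: "\<And>s a. s \<in> states G \<Longrightarrow> a \<in> joint_actions G \<Longrightarrow> \<bar>g s a\<bar> \<le> D"
    using g unfolding bounded_case_prod_image_iff by blast
  obtain C where C: "\<And>s. s \<in> states G \<Longrightarrow> \<bar>F s\<bar> \<le> C" using F by (auto simp: bounded_iff)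
  \<comment> \<open>With payoff 0 the zero function is a fixed point; it serves as the reference
    from which the size of \<open>bellman G g F\<close> is measured.\<close>
  have zero: "bellman G (\<lambda>_ _. 0) (\<lambda>_. 0) s = 0" for s
    using joint_actions_nonempty[OF G] by (simp add: bellman_def lebesgue_or_upper_integral_def)
  have "\<bar>bellman G g F s - bellman G (\<lambda>_ _. 0) (\<lambda>_. 0) s\<bar> \<le> D + discount G * C" if s: "s \<in> states G" for s
    by (rule bellman_abs_diff_le[OF G s g _ F]) (use C D s in \<open>auto simp: bounded_iff\<close>)
  then show ?thesis by (auto simp: bounded_iff zero)
qed

section \<open>Iterates of the Bellman operator and their convergence\<close>

lemma bounded_bellman_iterate:
  fixes G :: "('s::euclidean_space, 'a::euclidean_space, 'n::finite) game"
  assumes G: "continuous_stochastic_game G"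
    and g: "bounded ((\<lambda>(s, a). g s a) ` (states G \<times> joint_actions G))"
    and F: "bounded (F ` states G)"
  shows "bounded ((bellman G g ^^ k) F ` states G)"
  by (induction k) (simp_all add: F bounded_bellman[OF G g])

text \<open>One further step turns an error bound \<open>e\<close> into
  \<open>d + discount G * e\<close>; unrolling this recursion from \<open>c\<close> gives the
  geometric sum.\<close>

lemma bellman_iterates_abs_diff_le:
  fixes G :: "('s::euclidean_space, 'a::euclidean_space, 'n::finite) game"
  assumes G: "continuous_stochastic_game G" and s: "s \<in> states G"
    and g: "bounded ((\<lambda>(s, a). g s a) ` (states G \<times> joint_actions G))"
    and g': "bounded ((\<lambda>(s, a). g' s a) ` (states G \<times> joint_actions G))"
    and F: "bounded (F ` states G)" and F': "bounded (F' ` states G)"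
    and d: "\<And>s a. s \<in> states G \<Longrightarrow> a \<in> joint_actions G \<Longrightarrow> \<bar>g s a - g' s a\<bar> \<le> d"
    and c: "\<And>s. s \<in> states G \<Longrightarrow> \<bar>F s - F' s\<bar> \<le> c"
  shows "\<bar>(bellman G g ^^ k) F s - (bellman G g' ^^ k) F' s\<bar>
    \<le> d * (\<Sum>j<k. discount G ^ j) + discount G ^ k * c"
  using s
proof (induction k arbitrary: s)
  case 0
  then show ?case using c by simp
next
  case (Suc k)
  have "\<bar>bellman G g ((bellman G g ^^ k) F) s - bellman G g' ((bellman G g' ^^ k) F') s\<bar>
      \<le> d + discount G * (d * (\<Sum>j<k. discount G ^ j) + discount G ^ k * c)"
    by (rule bellman_abs_diff_le[OF G Suc.prems g g'
          bounded_bellman_iterate[OF G g F] bounded_bellman_iterate[OF G g' F'] d[OF Suc.prems] Suc.IH])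
  also have "\<dots> = d * (\<Sum>j<Suc k. discount G ^ j) + discount G ^ Suc k * c"
    unfolding sum.lessThan_Suc_shift by (simp add: algebra_simps sum_distrib_left)
  finally show ?case by simp
qed

text \<open>\<open>bellman_limit\<close> uses \<open>lim\<close>, which is informative only for
  convergent sequences. Successive iterates differ by at most a constant times
  \<open>discount G ^ k\<close>, so the increments are summable, and their sums telescope.\<close>

lemma bellman_iterates_convergent:
  fixes G :: "('s::euclidean_space, 'a::euclidean_space, 'n::finite) game"
  assumes G: "continuous_stochastic_game G" and s: "s \<in> states G"
    and g: "bounded ((\<lambda>(s, a). g s a) ` (states G \<times> joint_actions G))"
    and F: "bounded (F ` states G)"
  shows "convergent (\<lambda>k. (bellman G g ^^ k) F s)"
proof -
  let ?x = "\<lambda>k. (bellman G g ^^ k) F s"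
  have \<gamma>: "0 \<le> discount G" "discount G < 1" using G by (auto simp: continuous_stochastic_game_def)
  note TF = bounded_bellman[OF G g F]
  obtain C where "\<And>s. s \<in> states G \<Longrightarrow> \<bar>bellman G g F s\<bar> \<le> C" using TF by (auto simp: bounded_iff)
  moreover obtain C' where "\<And>s. s \<in> states G \<Longrightarrow> \<bar>F s\<bar> \<le> C'" using F by (auto simp: bounded_iff)
  ultimately have c: "\<bar>bellman G g F s - F s\<bar> \<le> C + C'" if "s \<in> states G" for s
    using that by (smt (verit))
  have "\<bar>?x (Suc k) - ?x k\<bar> \<le> discount G ^ k * (C + C')" for k
    \<comment> \<open>The iterate of order \<open>Suc k\<close> from \<open>F\<close> is the one of
      order \<open>k\<close> from \<open>bellman G g F\<close>. Equal payoffs give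
      \<open>d = 0\<close>, leaving only the contracted initial distance.\<close>
    using bellman_iterates_abs_diff_le[OF G s g g TF F _ c, of 0 k]
    by (simp add: funpow_Suc_right del: funpow.simps(2))
  then have "summable (\<lambda>k. ?x (Suc k) - ?x k)"
    by (intro summable_comparison_test'[OF summable_mult2[OF summable_geometric]]) (use \<gamma> in auto)
  then have "convergent (\<lambda>n. \<Sum>k<n. ?x (Suc k) - ?x k)"
    by (simp only: summable_iff_convergent)
  then have "convergent (\<lambda>n. ?x n - ?x 0)"
    by (simp only: sum_lessThan_telescope[of ?x])
  then show ?thesis
    by (simp add: convergent_diff_const_right_iff)
qed

section \<open>Trajectories and discounted sums\<close>

lemma prob_space_trajectory_law:
  fixes G :: "('s::euclidean_space, 'a::euclidean_space, 'n::finite) game"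
  assumes "continuous_stochastic_game G" and "\<pi> \<in> profiles G" and "s \<in> states G"
  shows "prob_space (trajectory_law G \<pi> s)"
    and "space (trajectory_law G \<pi> s) = UNIV \<rightarrow> states G \<times> joint_actions G"
proof -
  interpret Ionescu_Tulcea "step_law G \<pi> s" "\<lambda>_. state_space G \<Otimes>\<^sub>M action_space G"
    by (rule ionescu_tulcea_step_law[OF assms])
  \<comment> \<open>Total mass can be read off any finite marginal, since an image measure keeps it;
    the marginal on the empty index set is enough.\<close>
  have "(\<lambda>x. restrict x {}) \<in> PF.lim \<rightarrow>\<^sub>M PiM {} (\<lambda>_. state_space G \<Otimes>\<^sub>M action_space G)"
    by (subst measurable_cong_sets[OF PF.sets_lim refl]) (rule measurable_restrict_subset, simp)
  then have "prob_space PF.lim"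
    by (rule prob_space_distrD) (simp add: distr_lim PF.prob_space_P)
  then show "prob_space (trajectory_law G \<pi> s)" by (simp add: trajectory_law_def)
  show "space (trajectory_law G \<pi> s) = UNIV \<rightarrow> states G \<times> joint_actions G"
    unfolding trajectory_law_def PF.space_lim
    by (auto simp: space_PiM PiE_UNIV_domain space_pair_measure state_space_def
        action_space_def space_restrict_space)
qed

lemma bounded_expected_discounted_sum:
  fixes G :: "('s::euclidean_space, 'a::euclidean_space, 'n::finite) game"
  assumes G: "continuous_stochastic_game G" and \<pi>: "\<pi> \<in> profiles G"
    and g: "bounded ((\<lambda>(s, a). g s a) ` (states G \<times> joint_actions G))"
  shows "bounded (expected_discounted_sum G g \<pi> ` states G)"
proof -
  have \<gamma>: "0 \<le> discount G" "discount G < 1" using G by (auto simp: continuous_stochastic_game_def)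
  obtain D where D: "\<And>s a. s \<in> states G \<Longrightarrow> a \<in> joint_actions G \<Longrightarrow> \<bar>g s a\<bar> \<le> D"
    using g unfolding bounded_case_prod_image_iff by blast
  let ?C = "\<Sum>t. discount G ^ t * D"
  \<comment> \<open>No measurability of \<open>g\<close> is assumed, so the discounted sum may fail
    to be integrable. The maximum with 0 covers the default value 0 of the integral in that
    case.\<close>
  have "\<bar>expected_discounted_sum G g \<pi> s\<bar> \<le> max 0 ?C" if s: "s \<in> states G" for s
  proof -
    let ?f = "\<lambda>\<omega>. \<Sum>t. discount G ^ t * g (fst (\<omega> t)) (snd (\<omega> t))"
    interpret prob_space "trajectory_law G \<pi> s" by (rule prob_space_trajectory_law[OF G \<pi> s])
    have f: "\<bar>?f \<omega>\<bar> \<le> ?C" if "\<omega> \<in> space (trajectory_law G \<pi> s)" for \<omega>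
    proof -
      have "\<omega> t \<in> states G \<times> joint_actions G" for t
        using that unfolding prob_space_trajectory_law(2)[OF G \<pi> s] by blast
      then have "norm (discount G ^ t * g (fst (\<omega> t)) (snd (\<omega> t))) \<le> discount G ^ t * D" for t
        using D \<gamma> by (auto simp: abs_mult mem_Times_iff intro!: mult_left_mono)
      moreover have "summable (\<lambda>t. discount G ^ t * D)"
        using \<gamma> by (intro summable_mult2 summable_geometric) auto
      ultimately have "norm (?f \<omega>) \<le> ?C" by (rule norm_suminf_le)
      then show ?thesis by simp
    qed
    show ?thesis
    proof (cases "integrable (trajectory_law G \<pi> s) ?f")
      case True
      have "\<bar>integral\<^sup>L (trajectory_law G \<pi> s) ?f\<bar> \<le> (\<integral>\<omega>. \<bar>?f \<omega>\<bar> \<partial>trajectory_law G \<pi> s)" by simp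
      also have "\<dots> \<le> ?C" using True f by (intro integral_le_const) auto
      finally show ?thesis by (simp add: expected_discounted_sum_def)
    next
      case False
      then show ?thesis by (simp add: expected_discounted_sum_def not_integrable_integral_eq)
    qed
  qed
  then show ?thesis by (auto simp: bounded_iff)
qed

section \<open>Boundedness of the potential\<close>

lemma bounded_potential:
  fixes G :: "('s::euclidean_space, 'a::euclidean_space, 'n::finite) game"
  assumes G: "continuous_stochastic_game G"
    and pot: "is_potential G \<phi>" and trans: "state_transitive G \<phi>" and reg: "regular_rewards G"
  shows "bounded ((\<lambda>(s, a). \<phi> s a) ` (states G \<times> joint_actions G))"
proof -
  have "\<forall>i. \<exists>K. \<forall>s\<in>states G. \<forall>a\<in>joint_actions G. \<bar>reward G i s a\<bar> \<le> K"
    using reg unfolding regular_rewards_def bounded_case_prod_image_iff by blast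
  then obtain K where K: "\<And>i s a. s \<in> states G \<Longrightarrow> a \<in> joint_actions G \<Longrightarrow> \<bar>reward G i s a\<bar> \<le> K i"
    by metis
  \<comment> \<open>Interpolates between joint actions as the agents switch one at a time:
    \<open>I = {}\<close> gives \<open>a\<close> and \<open>I = UNIV\<close> gives
    \<open>b\<close>.\<close>
  define mix where "mix I a b = (\<chi> j. if j \<in> I then b $ j else a $ j)" for I and a b :: "'a^'n"
  have mix: "mix I a b \<in> joint_actions G" if "a \<in> joint_actions G" "b \<in> joint_actions G" for I a b
    using that by (auto simp: joint_actions_def mix_def)
  have diff: "\<bar>\<phi> s a - \<phi> s (mix I a b)\<bar> \<le> (\<Sum>i\<in>I. 2 * K i)"
    if s: "s \<in> states G" and a: "a \<in> joint_actions G" and b: "b \<in> joint_actions G" for I s a b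
    using finite[of I]
  proof (induction I rule: finite_induct)
    case empty
    then show ?case by (simp add: mix_def)
  next
    case (insert i I)
    \<comment> \<open>Adding one agent to the set is a unilateral deviation, so the potential
      identity for that agent applies.\<close>
    have eq: "mix (insert i I) a b = deviate (mix I a b) i (b $ i)"
      by (auto simp: mix_def deviate_def vec_eq_iff)
    have "b $ i \<in> actions G i" using b by (simp add: joint_actions_def)
    then have "\<phi> s (mix I a b) - \<phi> s (mix (insert i I) a b)
        = reward G i s (mix I a b) - reward G i s (mix (insert i I) a b)"
      using pot s mix[OF a b, of I] unfolding is_potential_def eq by simp
    then have "\<bar>\<phi> s (mix I a b) - \<phi> s (mix (insert i I) a b)\<bar> \<le> 2 * K i"
      using K[OF s mix[OF a b, of I], of i] K[OF s mix[OF a b, of "insert i I"], of i] by linarith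
    then show ?case using insert by simp
  qed
  obtain s0 where s0: "s0 \<in> states G" using G by (auto simp: continuous_stochastic_game_def)
  obtain a0 where a0: "a0 \<in> joint_actions G" using joint_actions_nonempty[OF G] by blast
  \<comment> \<open>Types are inhabited, so some agent exists; a single one suffices to control
    changes of state.\<close>
  fix i0 :: 'n
  have "\<bar>\<phi> s a\<bar> \<le> 2 * K i0 + (\<Sum>i\<in>UNIV. 2 * K i) + \<bar>\<phi> s0 a0\<bar>"
    if s: "s \<in> states G" and a: "a \<in> joint_actions G" for s a
  proof -
    \<comment> \<open>The path from \<open>(s, a)\<close> to \<open>(s0, a0)\<close> changes the
      state first, at fixed \<open>a\<close>, and then the action at \<open>s0\<close>.\<close>
    have "\<phi> s a - \<phi> s0 a = reward G i0 s a - reward G i0 s0 a"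
      using trans s s0 a by (simp add: state_transitive_def)
    moreover have "mix UNIV a a0 = a0" by (simp add: mix_def)
    ultimately show ?thesis
      using diff[OF s0 a a0, of UNIV] K[OF s a, of i0] K[OF s0 a, of i0] by simp
  qed
  then show ?thesis by (auto simp: bounded_iff)
qed

section \<open>Comparison of the two limits\<close>

theorem proposition3:
  fixes G :: "('s::euclidean_space, 'a::euclidean_space, 'n::finite) game"
    and \<phi> \<phi>\<^sub>\<epsilon> :: "'s \<Rightarrow> 'a^'n \<Rightarrow> real"
    and \<pi> \<pi>h :: "'n \<Rightarrow> ('s, 'a) strategy"
    and \<epsilon> :: real
  assumes "continuous_stochastic_game G"
    and "is_potential G \<phi>"
    and "state_transitive G \<phi>"
    and "regular_rewards G"
    and "\<pi> \<in> profiles G"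
    and "markov_perfect_equilibrium G \<pi>h"
    and "\<forall>s\<in>states G.
           (\<lambda>k. (bellman G \<phi> ^^ k) (dynamic_potential G \<phi> \<pi>) s) \<longlonglongrightarrow> dynamic_potential G \<phi> \<pi>h s"
    and "\<epsilon> > 0"
    and "sup_norm (states G \<times> joint_actions G) (\<lambda>(s, a). \<phi>\<^sub>\<epsilon> s a - \<phi> s a) < ereal \<epsilon>"
  shows "sup_norm (states G)
           (\<lambda>s. dynamic_potential G \<phi> \<pi>h s
                - bellman_limit G \<phi>\<^sub>\<epsilon> (dynamic_potential G \<phi> \<pi>) s)
         \<le> ereal ((2 - discount G) * inverse (1 - discount G) * \<epsilon>)"
proof -
  note G = assms(1)
  define B where "B = dynamic_potential G \<phi> \<pi>"
  have \<gamma>: "0 \<le> discount G" "discount G < 1" using G by (auto simp: continuous_stochastic_game_def)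
  have d: "\<bar>\<phi> s a - \<phi>\<^sub>\<epsilon> s a\<bar> \<le> \<epsilon>" if "s \<in> states G" "a \<in> joint_actions G" for s a
  proof -
    have "ereal \<bar>\<phi>\<^sub>\<epsilon> s a - \<phi> s a\<bar> \<le> sup_norm (states G \<times> joint_actions G) (\<lambda>(s, a). \<phi>\<^sub>\<epsilon> s a - \<phi> s a)"
      unfolding sup_norm_def by (rule SUP_upper2[of "(s, a)"]) (use that in auto)
    also note assms(9)
    finally show ?thesis by simp
  qed
  have \<phi>: "bounded ((\<lambda>(s, a). \<phi> s a) ` (states G \<times> joint_actions G))"
    by (rule bounded_potential[OF assms(1-4)])
  then obtain D where D: "\<And>s a. s \<in> states G \<Longrightarrow> a \<in> joint_actions G \<Longrightarrow> \<bar>\<phi> s a\<bar> \<le> D"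
    unfolding bounded_case_prod_image_iff by blast
  \<comment> \<open>Closeness to the bounded \<open>\<phi>\<close> makes
    \<open>\<phi>\<^sub>\<epsilon>\<close> bounded too, so its Bellman iterates converge.\<close>
  have "\<bar>\<phi>\<^sub>\<epsilon> s a\<bar> \<le> D + \<epsilon>" if "s \<in> states G" "a \<in> joint_actions G" for s a
    using D[OF that] d[OF that] by linarith
  then have \<phi>\<epsilon>: "bounded ((\<lambda>(s, a). \<phi>\<^sub>\<epsilon> s a) ` (states G \<times> joint_actions G))"
    by (auto simp: bounded_iff)
  have B: "bounded (B ` states G)"
    unfolding B_def dynamic_potential_def by (rule bounded_expected_discounted_sum[OF G assms(5) \<phi>])
  have "\<bar>dynamic_potential G \<phi> \<pi>h s - bellman_limit G \<phi>\<^sub>\<epsilon> B s\<bar>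
      \<le> (2 - discount G) * inverse (1 - discount G) * \<epsilon>" if s: "s \<in> states G" for s
  proof -
    have "(\<lambda>k. \<bar>(bellman G \<phi> ^^ k) B s - (bellman G \<phi>\<^sub>\<epsilon> ^^ k) B s\<bar>)
        \<longlonglongrightarrow> \<bar>dynamic_potential G \<phi> \<pi>h s - bellman_limit G \<phi>\<^sub>\<epsilon> B s\<bar>"
      using assms(7) s bellman_iterates_convergent[OF G s \<phi>\<epsilon> B]
      by (intro tendsto_rabs tendsto_diff) (auto simp: B_def bellman_limit_def convergent_LIMSEQ_iff)
    moreover have "\<bar>(bellman G \<phi> ^^ k) B s - (bellman G \<phi>\<^sub>\<epsilon> ^^ k) B s\<bar> \<le> \<epsilon> * inverse (1 - discount G)" for k
    proof -
      have "\<bar>(bellman G \<phi> ^^ k) B s - (bellman G \<phi>\<^sub>\<epsilon> ^^ k) B s\<bar>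
          \<le> \<epsilon> * (\<Sum>j<k. discount G ^ j) + discount G ^ k * 0"
        \<comment> \<open>Both iterations start from \<open>B\<close>, so the initial distance is 0
          and only the payoff error accumulates.\<close>
        by (rule bellman_iterates_abs_diff_le[OF G s \<phi> \<phi>\<epsilon> B B d]) auto
      also have "\<dots> \<le> \<epsilon> * (\<Sum>j. discount G ^ j)"
        using \<gamma> \<open>\<epsilon> > 0\<close> by (auto intro!: mult_left_mono sum_le_suminf summable_geometric)
      finally show ?thesis using \<gamma> by (simp add: suminf_geometric inverse_eq_divide)
    qed
    ultimately have "\<bar>dynamic_potential G \<phi> \<pi>h s - bellman_limit G \<phi>\<^sub>\<epsilon> B s\<bar> \<le> \<epsilon> * inverse (1 - discount G)"
      by (intro LIMSEQ_le_const2) auto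
    also have "\<dots> = 1 * inverse (1 - discount G) * \<epsilon>" by simp
    \<comment> \<open>Since \<open>discount G < 1\<close>, the factor \<open>2 - discount G\<close>
      is at least 1.\<close>
    also have "\<dots> \<le> (2 - discount G) * inverse (1 - discount G) * \<epsilon>"
      using \<gamma> \<open>\<epsilon> > 0\<close> by (intro mult_right_mono) auto
    finally show ?thesis .
  qed
  then show ?thesis unfolding sup_norm_def B_def by (intro SUP_least) simp
qed

end
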